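(* Let $$P=-\begin{pmatrix}0&1&0&0\\1&2&1&1\\0&1&0&0\\0&1&0&0\end{pmatrix},\qquad \mathbf{P}=\begin{pmatrix}0&P&0&0\\P&0&0&0\\0&0&0&P\\0&0&P&0\end{pmatrix}\in\mathbb{R}^{16\times16}$$ (a $4\times 4$ block matrix with $4\times4$ blocks). Then $$\mathbf{P}\notin\{\mathbf{X}\in\mathbb{R}^{16\times16}:\ G\otimes E+E\otimes H+\mathbf{X}\succeq 0\ \text{for some } G,H\in\mathbb{R}^{4\times4}\}.$$
   Context: $E\in\mathbb{R}^{4\times4}$ is the all-ones matrix; $\otimes$ is the Kronecker product (so $G\otimes E$ has $(i,j)$ block $G_{ij}E$); $N\succeq0$ means $N$ is symmetric positive semidefinite. *)

theory Defs
  imports Complex_Main "Jordan_Normal_Form.Matrix"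
begin

definition kronecker_prod :: "'a :: times mat \<Rightarrow> 'a mat \<Rightarrow> 'a mat" (infixl "\<otimes>\<^sub>K" 70) where
  "A \<otimes>\<^sub>K B = mat (dim_row A * dim_row B) (dim_col A * dim_col B)
     (\<lambda>(i, j). A $$ (i div dim_row B, j div dim_col B) * B $$ (i mod dim_row B, j mod dim_col B))"

(* The rows of blocks are listed in Bss; every block is n x n and the list of lists is square. *)
definition square_block_mat :: "nat \<Rightarrow> 'a mat list list \<Rightarrow> 'a mat" where
  "square_block_mat n Bss = mat (length Bss * n) (length Bss * n)
     (\<lambda>(i, j). (Bss ! (i div n) ! (j div n)) $$ (i mod n, j mod n))"

definition pos_semidef :: "real mat \<Rightarrow> bool" where
  "pos_semidef N \<longleftrightarrow> square_mat N \<and> transpose_mat N = N \<and>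
     (\<forall>v \<in> carrier_vec (dim_row N). v \<bullet> (N *\<^sub>v v) \<ge> 0)"

definition all_ones :: "nat \<Rightarrow> real mat" where
  "all_ones n = mat n n (\<lambda>_. 1)"

definition P_mat :: "real mat" where
  "P_mat = - mat_of_rows_list 4
     [[0, 1, 0, 0],
      [1, 2, 1, 1],
      [0, 1, 0, 0],
      [0, 1, 0, 0]]"

definition P_block :: "real mat" where
  "P_block = (let Z = 0\<^sub>m 4 4; P = P_mat in square_block_mat 4
     [[Z, P, Z, Z],
      [P, Z, Z, Z],
      [Z, Z, Z, P],
      [Z, Z, P, Z]])"

lemma kronecker_prod_carrier [simp]:
  "A \<in> carrier_mat m n \<Longrightarrow> B \<in> carrier_mat p q \<Longrightarrow> A \<otimes>\<^sub>K B \<in> carrier_mat (m * p) (n * q)"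
  by (auto simp: kronecker_prod_def)

lemma all_ones_carrier [simp]: "all_ones n \<in> carrier_mat n n"
  by (simp add: all_ones_def)

lemma P_mat_carrier [simp]: "P_mat \<in> carrier_mat 4 4"
  by (rule carrier_matI) (simp_all add: P_mat_def mat_of_rows_list_def)

(* Non-membership of P_block in a set of 16 x 16 matrices is therefore not a matter of dimension. *)
lemma P_block_carrier [simp]: "P_block \<in> carrier_mat 16 16"
  by (rule carrier_matI) (simp_all add: P_block_def square_block_mat_def Let_def)

end

theory Submission
  imports Defs
begin

text \<open>
  Read a vector of length 16 as a \<open>4 \<times> 4\<close> array, one row per block. The matrix \<open>G \<otimes> E\<close> sees an
  array only through its row sums, and \<open>E \<otimes> H\<close> only through its column sums, so both kill an
  array whose rows and columns all sum to zero; on such an array \<open>v\<close> the matrix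
  \<open>N = G \<otimes> E + E \<otimes> H + \<^bold>P\<close> acts as \<open>\<^bold>P\<close>, whatever \<open>G\<close> and \<open>H\<close> are.

  Since \<open>P = -(e 1\<^sup>T + 1 e\<^sup>T)\<close> with \<open>e\<close> the second unit vector and \<open>1\<close> the all-ones vector, the
  quadratic form of \<open>\<^bold>P\<close> vanishes on all these arrays, although \<open>\<^bold>P\<close> does not annihilate them: it
  maps them into the orthogonal complement of their span. A positive semidefinite matrix cannot do this, because
  it annihilates every vector on which its quadratic form vanishes. The array \<open>v\<close> with rows
  \<open>(-1, 1, 0, 0)\<close>, \<open>(1, -1, 0, 0)\<close>, \<open>0\<close>, \<open>0\<close> exhibits the contradiction.

  No single separating functional can give this result. A positive semidefinite matrix that is
  orthogonal to all \<open>G \<otimes> E + E \<otimes> H\<close> is a sum of \<open>v v\<^sup>T\<close> over such arrays \<open>v\<close>, and all these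
  have inner product zero with \<open>\<^bold>P\<close>. This is why the argument uses the vanishing of \<open>N v\<close> and
  not just the sign of a quadratic form.
\<close>

text \<open>
  If the form vanishes at \<open>v\<close>, then along the line \<open>v + t w\<close> it equals
  \<open>2 t (w \<bullet> N v) + t\<^sup>2 (w \<bullet> N w)\<close>, which is nonnegative for all small \<open>t\<close> of either sign only if
  its linear coefficient is zero. Taking \<open>w = N v\<close> gives the claim.
\<close>

lemma pos_semidef_isotropic_imp_kernel:
  assumes psd: "pos_semidef N" and N: "N \<in> carrier_mat n n"
    and v: "v \<in> carrier_vec n" and iso: "v \<bullet> (N *\<^sub>v v) = 0"
  shows "N *\<^sub>v v = 0\<^sub>v n"
proof -
  define w where "w = N *\<^sub>v v"
  define b where "b = w \<bullet> (N *\<^sub>v w)"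
  have w: "w \<in> carrier_vec n" and Nw: "N *\<^sub>v w \<in> carrier_vec n"
    using N v by (auto simp: w_def)
  have nonneg: "u \<bullet> (N *\<^sub>v u) \<ge> 0" if "u \<in> carrier_vec n" for u
    using psd N that by (auto simp: pos_semidef_def)
  have vNw: "v \<bullet> (N *\<^sub>v w) = w \<bullet> w"
    using transpose_vec_mult_scalar[OF N w v] psd
    by (simp add: w_def pos_semidef_def)
  have line: "0 \<le> 2 * t * (w \<bullet> w) + t\<^sup>2 * b" for t
  proof -
    have "(v + t \<cdot>\<^sub>v w) \<bullet> (N *\<^sub>v (v + t \<cdot>\<^sub>v w)) = (v + t \<cdot>\<^sub>v w) \<bullet> (w + t \<cdot>\<^sub>v (N *\<^sub>v w))"
      using N v w by (simp add: mult_add_distrib_mat_vec mult_mat_vec w_def)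
    also have "\<dots> = v \<bullet> w + t * (v \<bullet> (N *\<^sub>v w)) + t * (w \<bullet> w) + t * t * b"
      using v w Nw
      by (simp add: add_scalar_prod_distrib[where n = n] scalar_prod_add_distrib[where n = n]
          b_def algebra_simps)
    also have "\<dots> = 2 * t * (w \<bullet> w) + t\<^sup>2 * b"
      using iso vNw by (simp add: w_def power2_eq_square)
    finally show ?thesis
      using nonneg[of "v + t \<cdot>\<^sub>v w"] v w by simp
  qed
  have "b \<ge> 0"
    using nonneg[OF w] by (simp add: b_def)
  have "w \<bullet> w = 0"
  proof (rule ccontr)
    assume "w \<bullet> w \<noteq> 0"
    then have pos: "w \<bullet> w > 0"
      using conjugate_square_ge_0_vec[of w] by (simp add: less_le)
    \<comment> \<open>Small enough for the linear term to dominate; the \<open>1\<close> covers the case \<open>b = 0\<close>.\<close>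
    define t where "t = - (w \<bullet> w) / (1 + b)"
    have "t < 0"
      using pos \<open>b \<ge> 0\<close> by (simp add: t_def divide_less_0_iff)
    have ww: "w \<bullet> w = - t * (1 + b)"
      using \<open>b \<ge> 0\<close> by (simp add: t_def)
    have "2 * t * (w \<bullet> w) + t\<^sup>2 * b = - (t\<^sup>2 * (2 + b))"
      unfolding ww by (simp add: algebra_simps power2_eq_square)
    also have "\<dots> < 0"
      using \<open>t < 0\<close> \<open>b \<ge> 0\<close> by simp
    finally show False
      using line[of t] by linarith
  qed
  then show ?thesis
    using w conjugate_square_eq_0_vec[OF w] by (simp add: w_def)
qed

lemma sum_blocks:
  fixes f :: "nat \<Rightarrow> 'a :: comm_monoid_add"
  shows "(\<Sum>k<n * m. f k) = (\<Sum>i<n. \<Sum>j<m. f (i * m + j))"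
proof -
  have "(\<Sum>k<n * m. f k) = (\<Sum>i<n. sum f {i * m..<i * m + m})"
    by (rule sum.nat_group [symmetric])
  also have "\<dots> = (\<Sum>i<n. \<Sum>j<m. f (i * m + j))"
    by (rule sum.cong) (simp_all add: sum.atLeastLessThan_shift_0[of f "i * m" "i * m + m" for i] atLeast0LessThan comp_def)
  finally show ?thesis .
qed

lemma kronecker_prod_mult_vec_index:
  assumes A: "A \<in> carrier_mat p n" and B: "B \<in> carrier_mat q m"
    and v: "v \<in> carrier_vec (n * m)" and i: "i < p * q"
  shows "((A \<otimes>\<^sub>K B) *\<^sub>v v) $ i =
    (\<Sum>k<n. \<Sum>l<m. A $$ (i div q, k) * B $$ (i mod q, l) * v $ (k * m + l))"
proof -
  have "((A \<otimes>\<^sub>K B) *\<^sub>v v) $ i = (\<Sum>j<n * m. (A \<otimes>\<^sub>K B) $$ (i, j) * v $ j)"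
    using assms by (auto simp: kronecker_prod_def scalar_prod_def atLeast0LessThan)
  also have "\<dots> = (\<Sum>j<n * m. A $$ (i div q, j div m) * B $$ (i mod q, j mod m) * v $ j)"
    using A B i by (auto simp: kronecker_prod_def intro!: sum.cong)
  finally show ?thesis
    by (simp add: sum_blocks)
qed

text \<open>
  Each block \<open>G\<^bsub>ij\<^esub> E\<close> of \<open>G \<otimes> E\<close> has constant rows, so only the sum over each block of
  \<open>v\<close> enters the product.
\<close>

lemma kronecker_all_ones_right_kernel:
  assumes G: "G \<in> carrier_mat n n" and v: "v \<in> carrier_vec (n * m)"
    and rows: "\<And>k. k < n \<Longrightarrow> (\<Sum>l<m. v $ (k * m + l)) = 0"
  shows "(G \<otimes>\<^sub>K all_ones m) *\<^sub>v v = 0\<^sub>v (n * m)"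
proof (rule eq_vecI)
  fix i assume "i < dim_vec (0\<^sub>v (n * m) :: real vec)"
  then have i: "i < n * m" and "m > 0"
    by (auto intro: gr0I)
  have "((G \<otimes>\<^sub>K all_ones m) *\<^sub>v v) $ i = (\<Sum>k<n. \<Sum>l<m. G $$ (i div m, k) * v $ (k * m + l))"
    using kronecker_prod_mult_vec_index[OF G all_ones_carrier v i] \<open>m > 0\<close>
    by (simp add: all_ones_def)
  also have "\<dots> = 0"
    by (simp add: rows flip: sum_distrib_left)
  finally show "((G \<otimes>\<^sub>K all_ones m) *\<^sub>v v) $ i = 0\<^sub>v (n * m) $ i"
    using i by simp
qed (use G in \<open>simp add: kronecker_prod_def all_ones_def\<close>)

text \<open>All blocks of \<open>E \<otimes> H\<close> are equal to \<open>H\<close>, so only the sum of the blocks of \<open>v\<close> enters.\<close>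

lemma kronecker_all_ones_left_kernel:
  assumes H: "H \<in> carrier_mat m m" and v: "v \<in> carrier_vec (n * m)"
    and cols: "\<And>l. l < m \<Longrightarrow> (\<Sum>k<n. v $ (k * m + l)) = 0"
  shows "(all_ones n \<otimes>\<^sub>K H) *\<^sub>v v = 0\<^sub>v (n * m)"
proof (rule eq_vecI)
  fix i assume "i < dim_vec (0\<^sub>v (n * m) :: real vec)"
  then have i: "i < n * m"
    by simp
  then have "i div m < n"
    by (simp add: less_mult_imp_div_less)
  have "((all_ones n \<otimes>\<^sub>K H) *\<^sub>v v) $ i = (\<Sum>k<n. \<Sum>l<m. H $$ (i mod m, l) * v $ (k * m + l))"
    using kronecker_prod_mult_vec_index[OF all_ones_carrier H v i] \<open>i div m < n\<close>
    by (simp add: all_ones_def)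
  also have "\<dots> = (\<Sum>l<m. \<Sum>k<n. H $$ (i mod m, l) * v $ (k * m + l))"
    by (rule sum.swap)
  also have "\<dots> = 0"
    by (simp add: cols flip: sum_distrib_left)
  finally show "((all_ones n \<otimes>\<^sub>K H) *\<^sub>v v) $ i = 0\<^sub>v (n * m) $ i"
    using i by simp
qed (use H in \<open>simp add: kronecker_prod_def all_ones_def\<close>)

text \<open>
  Let \<open>1\<close> be the all-ones vector. As \<open>P x = - x\<^sub>2 1\<close> for a vector \<open>x\<close> with coordinate sum zero, any
  array with vanishing row and column sums and a nonzero entry in its second column would serve.
\<close>

definition witness_vec :: "real vec" where
  "witness_vec = vec_of_list [-1, 1, 0, 0, 1, -1, 0, 0, 0, 0, 0, 0, 0, 0, 0, 0]"

lemma witness_vec_carrier: "witness_vec \<in> carrier_vec 16"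
  by (rule carrier_vecI) (simp add: witness_vec_def)

lemma witness_vec_row_sum: "k < 4 \<Longrightarrow> (\<Sum>l<4. witness_vec $ (k * 4 + l)) = 0"
  by (auto simp: witness_vec_def numeral_eq_Suc less_Suc_eq)

lemma witness_vec_col_sum: "l < 4 \<Longrightarrow> (\<Sum>k<4. witness_vec $ (k * 4 + l)) = 0"
  by (auto simp: witness_vec_def numeral_eq_Suc less_Suc_eq)

lemma P_block_mult_witness_vec:
  "P_block *\<^sub>v witness_vec = vec_of_list [1, 1, 1, 1, -1, -1, -1, -1, 0, 0, 0, 0, 0, 0, 0, 0]"
proof (rule eq_vecI)
  fix i assume "i < dim_vec (vec_of_list [1, 1, 1, 1, -1, -1, -1, -1, 0, 0, 0, 0, 0, 0, 0, 0] :: real vec)"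
  then have "i < 4 * 4"
    by simp
  then obtain a b where i: "i = a * 4 + b" and a: "a < 4" and b: "b < 4"
    using div_mult_mod_eq[of i 4] by (metis less_mult_imp_div_less mod_less_divisor zero_less_numeral)
  have "(P_block *\<^sub>v witness_vec) $ i = (\<Sum>j<4 * 4. P_block $$ (i, j) * witness_vec $ j)"
    using carrier_matD[OF P_block_carrier] carrier_vecD[OF witness_vec_carrier] \<open>i < 4 * 4\<close>
    by (auto simp: scalar_prod_def atLeast0LessThan)
  also have "\<dots> = (\<Sum>k<4. \<Sum>l<4. P_block $$ (a * 4 + b, k * 4 + l) * witness_vec $ (k * 4 + l))"
    unfolding sum_blocks i by (rule refl)
  also have "\<dots> = vec_of_list [1, 1, 1, 1, -1, -1, -1, -1, 0, 0, 0, 0, 0, 0, 0, 0] $ i"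
  proof -
    have four: "{..<4::nat} = {0, 1, 2, 3}" by auto
    have "a \<in> {0, 1, 2, 3}" "b \<in> {0, 1, 2, 3}"
      using a b by auto
    then show ?thesis
      unfolding i four
      by (auto simp: P_block_def square_block_mat_def P_mat_def mat_of_rows_list_def Let_def
          witness_vec_def vec_of_list_index simp del: vec_of_list_Cons)
  qed
  finally show "(P_block *\<^sub>v witness_vec) $ i =
    vec_of_list [1, 1, 1, 1, -1, -1, -1, -1, 0, 0, 0, 0, 0, 0, 0, 0] $ i" .
qed (simp add: P_block_def square_block_mat_def Let_def)

theorem proposition6p2:
  shows "P_block \<notin> {X \<in> carrier_mat 16 16.
           \<exists>G \<in> carrier_mat 4 4. \<exists>H \<in> carrier_mat 4 4.
             pos_semidef (G \<otimes>\<^sub>K all_ones 4 + all_ones 4 \<otimes>\<^sub>K H + X)}"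
proof
  assume "P_block \<in> {X \<in> carrier_mat 16 16.
           \<exists>G \<in> carrier_mat 4 4. \<exists>H \<in> carrier_mat 4 4.
             pos_semidef (G \<otimes>\<^sub>K all_ones 4 + all_ones 4 \<otimes>\<^sub>K H + X)}"
  then obtain G H where G: "G \<in> carrier_mat 4 4" and H: "H \<in> carrier_mat 4 4"
    and psd: "pos_semidef (G \<otimes>\<^sub>K all_ones 4 + all_ones 4 \<otimes>\<^sub>K H + P_block)"
    by blast
  let ?v = witness_vec
  let ?N = "G \<otimes>\<^sub>K all_ones 4 + all_ones 4 \<otimes>\<^sub>K H + P_block"
  have GE: "G \<otimes>\<^sub>K all_ones 4 \<in> carrier_mat 16 16"
    using kronecker_prod_carrier[OF G all_ones_carrier[of 4]] by simp
  have EH: "all_ones 4 \<otimes>\<^sub>K H \<in> carrier_mat 16 16"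
    using kronecker_prod_carrier[OF all_ones_carrier[of 4] H] by simp
  have "?N *\<^sub>v ?v = (G \<otimes>\<^sub>K all_ones 4) *\<^sub>v ?v + (all_ones 4 \<otimes>\<^sub>K H) *\<^sub>v ?v + P_block *\<^sub>v ?v"
    using GE EH witness_vec_carrier
    by (metis P_block_carrier add_carrier_mat add_mult_distrib_mat_vec)
  also have "\<dots> = P_block *\<^sub>v ?v"
    using kronecker_all_ones_right_kernel[OF G, of ?v 4] kronecker_all_ones_left_kernel[OF H, of ?v 4]
      witness_vec_row_sum witness_vec_col_sum witness_vec_carrier
      mult_mat_vec_carrier[OF P_block_carrier witness_vec_carrier]
    by simp
  finally have Nv: "?N *\<^sub>v ?v = P_block *\<^sub>v ?v" .
  have "?v \<bullet> (?N *\<^sub>v ?v) = 0"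
    unfolding Nv P_block_mult_witness_vec
    by (simp add: witness_vec_def scalar_prod_def numeral_eq_Suc)
  then have "P_block *\<^sub>v ?v = 0\<^sub>v 16"
    using pos_semidef_isotropic_imp_kernel[OF psd _ witness_vec_carrier] GE EH Nv by simp
  then have "(P_block *\<^sub>v ?v) $ 0 = 0"
    by simp
  then show False
    by (simp add: P_block_mult_witness_vec)
qed

end
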